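(* Let $p$ be a prime, $q$ a power of $p$, and $k\ge0$ an integer. The map $\bar{\mathcal{G}}_k:\mathbf{F}_q^2\to\mathbf{F}_q^2$ obtained by reducing the integer coefficients of $\mathcal{G}_k$ modulo $p$ is a permutation of $\mathbf{F}_q^2$ if and only if $\gcd(k,q^6-1)=1$.
   Context: Define $\varPhi_{G_2}=(\varphi_1,\varphi_2):\mathbf{C}^2\to\mathbf{C}^2$ by $\varphi_1(\sigma,\tau)=e^{2\pi i\sigma}+e^{2\pi i\tau}+e^{2\pi i(\sigma+\tau)}+e^{-2\pi i\sigma}+e^{-2\pi i\tau}+e^{-2\pi i(\sigma+\tau)}$ and $\varphi_2(\sigma,\tau)=e^{2\pi i(2\sigma+\tau)}+e^{2\pi i(\sigma+2\tau)}+e^{2\pi i(\sigma-\tau)}+e^{-2\pi i(2\sigma+\tau)}+e^{-2\pi i(\sigma+2\tau)}+e^{-2\pi i(\sigma-\tau)}$. For each integer $k\ge0$, $\mathcal{G}_k:\mathbf{C}^2\to\mathbf{C}^2$ is the unique polynomial map (it has integer coefficients) such that $\varPhi_{G_2}(k\sigma,k\tau)=\mathcal{G}_k(\varPhi_{G_2}(\sigma,\tau))$ for all $\sigma,\tau\in\mathbf{C}$; e.g. $\mathcal{G}_0=(6,6)$, $\mathcal{G}_1(x,y)=(x,y)$. This is the family associated with the Lie algebra $G_2$. *)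

theory Defs
  imports Complex_Main "HOL-Library.Cardinality" "HOL-Computational_Algebra.Computational_Algebra"
begin

definition e2pi :: "complex \<Rightarrow> complex" where
  "e2pi z = exp (2 * of_real pi * \<i> * z)"

definition phi1 :: "complex \<Rightarrow> complex \<Rightarrow> complex" where
  "phi1 \<sigma> \<tau> = e2pi \<sigma> + e2pi \<tau> + e2pi (\<sigma> + \<tau>)
            + e2pi (- \<sigma>) + e2pi (- \<tau>) + e2pi (- (\<sigma> + \<tau>))"

definition phi2 :: "complex \<Rightarrow> complex \<Rightarrow> complex" where
  "phi2 \<sigma> \<tau> = e2pi (2 * \<sigma> + \<tau>) + e2pi (\<sigma> + 2 * \<tau>) + e2pi (\<sigma> - \<tau>)
            + e2pi (- (2 * \<sigma> + \<tau>)) + e2pi (- (\<sigma> + 2 * \<tau>)) + e2pi (- (\<sigma> - \<tau>))"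

definition Phi_G2 :: "complex \<times> complex \<Rightarrow> complex \<times> complex" where
  "Phi_G2 = (\<lambda>(\<sigma>, \<tau>). (phi1 \<sigma> \<tau>, phi2 \<sigma> \<tau>))"

(* An integer polynomial in x and y is an "int poly poly" whose outer variable is y: the
   coefficient of x^i y^j is "coeff (coeff P j) i". Integer coefficients enter the ring 'a
   through of_int; in characteristic p this is reduction modulo p. *)
definition eval2 :: "int poly poly \<Rightarrow> 'a::comm_ring_1 \<Rightarrow> 'a \<Rightarrow> 'a" where
  "eval2 P x y = poly (poly (map_poly (map_poly of_int) P) [:y:]) x"

definition poly_map2 ::
  "int poly poly \<times> int poly poly \<Rightarrow> 'a::comm_ring_1 \<times> 'a \<Rightarrow> 'a \<times> 'a" where
  "poly_map2 PQ = (\<lambda>(x, y). (eval2 (fst PQ) x y, eval2 (snd PQ) x y))"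

definition G2_poly :: "nat \<Rightarrow> int poly poly \<times> int poly poly" where
  "G2_poly k = (THE PQ. \<forall>\<sigma> \<tau>.
     Phi_G2 (of_nat k * \<sigma>, of_nat k * \<tau>) = poly_map2 PQ (Phi_G2 (\<sigma>, \<tau>)))"

end

theory Submission
  imports Defs "HOL-Algebra.Algebraic_Closure_Type" "HOL-Number_Theory.Residues"
begin

text \<open>
  For \<open>a b c = 1\<close> put \<open>s = a + b + c\<close> and \<open>r = ab + bc + ca = 1/a + 1/b + 1/c\<close>. With \<open>a, b\<close> the
  exponentials of \<open>\<sigma>, \<tau>\<close> one has \<open>\<Phi> = (s + r, s r - 3)\<close>, and this formula makes sense over any
  commutative ring; the \<open>k\<close>-th map sends the point of \<open>(a, b, c)\<close> to that of \<open>(a\<^sup>k, b\<^sup>k, c\<^sup>k)\<close>.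
  Over an algebraically closed field every point arises in this way. If it is rational over the
  field with \<open>q\<close> elements, then Frobenius fixes or swaps \<open>s\<close> and \<open>r\<close>, so it maps \<open>{a, b, c}\<close> to
  itself, possibly after inversion; hence \<open>a, b, c\<close> are \<open>(q\<^sup>6 - 1)\<close>-th roots of unity. If \<open>k\<close> is
  invertible modulo \<open>q\<^sup>6 - 1\<close> with inverse \<open>m\<close>, the \<open>m\<close>-th map therefore inverts the \<open>k\<close>-th.
  Conversely, let a prime \<open>l\<close> divide \<open>k\<close> and \<open>q\<^sup>6 - 1 = (q - 1)(q + 1)(q\<^sup>4 + q\<^sup>2 + 1)\<close>, and let \<open>z\<close>
  be a nontrivial \<open>l\<close>-th root of unity. Then \<open>(z, 1/z, 1)\<close> or, if \<open>l\<close> divides the last factor, the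
  triple of \<open>z\<close> and its images under the second and fourth powers of Frobenius
  yields a rational point other than \<open>(6, 6)\<close>, the point of \<open>(1, 1, 1)\<close>, with the same image.
\<close>

hide_const (open) Divisibility.prime Module.smult Polynomials.degree up_ring.coeff up_ring.monom

section \<open>Evaluation of integer polynomials in two variables\<close>

lemma map_poly_of_int_add:
  "map_poly of_int (p + q) = (map_poly of_int p + map_poly of_int q :: 'a::comm_ring_1 poly)"
  by (intro poly_eqI) (simp add: coeff_map_poly)

lemma map_poly_of_int_mult:
  "map_poly of_int (p * q) = (map_poly of_int p * map_poly of_int q :: 'a::comm_ring_1 poly)"
  by (intro poly_eqI) (simp add: coeff_map_poly coeff_mult)

lemma eval2_0 [simp]: "eval2 0 x y = 0"
  by (simp add: eval2_def)

lemma eval2_pCons [simp]: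
  "eval2 (pCons c P) x y = poly (map_poly of_int c) x + y * eval2 P x y"
  by (simp add: eval2_def map_poly_pCons)

lemma eval2_add [simp]: "eval2 (P + Q) x y = eval2 P x y + eval2 Q x y"
  by (induction P Q rule: poly_induct2) (simp_all add: map_poly_of_int_add algebra_simps)

lemma eval2_smult: "eval2 (smult c P) x y = poly (map_poly of_int c) x * eval2 P x y"
  by (induction P) (simp_all add: map_poly_of_int_mult algebra_simps)

lemma eval2_mult [simp]: "eval2 (P * Q) x y = eval2 P x y * eval2 Q x y"
  by (induction P) (simp_all add: eval2_smult algebra_simps)

lemma eval2_minus [simp]: "eval2 (- P) x y = - eval2 P x y"
  using eval2_add[of P "- P" x y] by (simp add: eq_neg_iff_add_eq_0 add.commute)

lemma eval2_diff [simp]: "eval2 (P - Q) x y = eval2 P x y - eval2 Q x y"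
  using eval2_add[of P "- Q" x y] by simp

lemma eval2_1 [simp]: "eval2 1 x y = 1"
  by (simp add: one_pCons map_poly_pCons)

lemma eval2_numeral [simp]: "eval2 (numeral n) x y = numeral n"
  by (simp add: numeral_poly map_poly_pCons)

lemma eval2_power [simp]: "eval2 (P ^ n) x y = eval2 P x y ^ n"
  by (induction n) simp_all

lemma to_ac_poly_of_int:
  "to_ac (poly (map_poly of_int p) x) = poly (map_poly of_int p) (to_ac x)"
  by (induction p) (simp_all add: map_poly_pCons)

lemma to_ac_eval2: "to_ac (eval2 P x y) = eval2 P (to_ac x) (to_ac y)"
  by (induction P) (simp_all add: to_ac_poly_of_int)

text \<open>Supplies the uniqueness behind the \<open>THE\<close> in \<open>G2_poly\<close>: as a
  polynomial in y over the domain of complex polynomials in x, \<open>Q\<close> has every constant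
  \<open>[:y:]\<close> as a root, which is too many unless it is zero.\<close>

lemma eval2_complex_eq_0D:
  assumes "\<And>x y :: complex. eval2 P x y = 0"
  shows "P = 0"
proof -
  define Q :: "complex poly poly" where "Q = map_poly (map_poly of_int) P"
  have "poly Q [:y:] = 0" for y
    using assms by (intro poly_eq_poly_eq_iff[THEN iffD1] ext) (simp add: eval2_def Q_def)
  hence "range (\<lambda>y. [:y:]) \<subseteq> {z. poly Q z = 0}"
    by auto
  moreover have "infinite (range (\<lambda>y::complex. [:y:]))"
    using infinite_UNIV_char_0[where ?'a = complex] by (auto dest!: finite_imageD simp: inj_def)
  ultimately have "Q = 0"
    using poly_roots_finite finite_subset by blast
  hence "coeff (coeff Q j) i = 0" for i j
    by simp
  thus "P = 0"
    by (intro poly_eqI) (simp add: Q_def coeff_map_poly)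
qed

lemma eval2_complex_eqD:
  assumes "\<And>x y :: complex. eval2 P x y = eval2 Q x y"
  shows "P = Q"
  using eval2_complex_eq_0D[of "P - Q"] assms by simp

section \<open>Power sums of triples with product 1\<close>

definition G2_point :: "'a::comm_ring_1 \<Rightarrow> 'a \<Rightarrow> 'a \<Rightarrow> 'a \<times> 'a" where
  "G2_point a b c = (let s = a + b + c; r = a * b + b * c + c * a in (s + r, s * r - 3))"

text \<open>
  The pair \<open>(A, B)\<close> stands for \<open>A + B s\<close> in \<open>\<int>[x, y][s] / (s\<^sup>2 - x s + y + 3)\<close>; the conjugate
  of \<open>s\<close> is \<open>r = x - s\<close>. The recursion is \<open>p\<^sub>k\<^sub>+\<^sub>3 = s p\<^sub>k\<^sub>+\<^sub>2 - r p\<^sub>k\<^sub>+\<^sub>1 + p\<^sub>k\<close> for the power sums of the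
  roots of \<open>T\<^sup>3 - s T\<^sup>2 + r T - 1\<close>.
\<close>

definition X2 :: "int poly poly" where "X2 = [:[:0, 1:]:]"

definition M2 :: "int poly poly" where "M2 = [:3, 1:]"

lemma eval2_X2 [simp]: "eval2 X2 x y = x"
  by (simp add: X2_def map_poly_pCons)

lemma eval2_M2 [simp]: "eval2 M2 x y = y + 3"
  by (simp add: M2_def map_poly_pCons numeral_poly)

fun power_sum_poly :: "nat \<Rightarrow> int poly poly \<times> int poly poly" where
  "power_sum_poly 0 = (3, 0)"
| "power_sum_poly (Suc 0) = (0, 1)"
| "power_sum_poly (Suc (Suc 0)) = (- M2 - 2 * X2, X2 + 2)"
| "power_sum_poly (Suc (Suc (Suc k))) =
    (let (A0, B0) = power_sum_poly k; (A1, B1) = power_sum_poly (Suc k);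
         (A2, B2) = power_sum_poly (Suc (Suc k))
     in (- (M2 * B2) - X2 * A1 - M2 * B1 + A0, A2 + X2 * B2 + A1 + B0))"

text \<open>The \<open>k\<close>-th power sum is \<open>A + B s\<close> and its conjugate is
  \<open>A + B r\<close>. The entries are their sum and their product minus 3, where
  \<open>X2\<close> stands for \<open>s + r\<close> and \<open>M2\<close> for
  \<open>s r\<close>.\<close>

definition G2_poly_explicit :: "nat \<Rightarrow> int poly poly \<times> int poly poly" where
  "G2_poly_explicit k = (let (A, B) = power_sum_poly k
     in (2 * A + X2 * B, A\<^sup>2 + X2 * A * B + M2 * B\<^sup>2 - 3))"

lemma power_sum_poly_eval:
  fixes a b c :: "'a::comm_ring_1"
  assumes abc: "a * b * c = 1"
  defines "s \<equiv> a + b + c" and "r \<equiv> a * b + b * c + c * a"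
  defines "E \<equiv> \<lambda>P. eval2 P (s + r) (s * r - 3)"
  shows "a ^ k + b ^ k + c ^ k = E (fst (power_sum_poly k)) + E (snd (power_sum_poly k)) * s"
proof (induction k rule: power_sum_poly.induct)
  case 3
  show ?case
    by (simp add: E_def s_def r_def algebra_simps power2_eq_square)
next
  case (4 k)
  obtain A0 B0 where 0: "power_sum_poly k = (A0, B0)" by fastforce
  obtain A1 B1 where 1: "power_sum_poly (Suc k) = (A1, B1)" by fastforce
  obtain A2 B2 where 2: "power_sum_poly (Suc (Suc k)) = (A2, B2)" by fastforce
  have cubic: "z ^ Suc (Suc (Suc k)) = s * z ^ Suc (Suc k) - r * z ^ Suc k + z ^ k"
    if "z \<in> {a, b, c}" for z
  proof -
    \<comment> \<open>Writing the constant 1 as \<open>a * b * c\<close> turns this into a formal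
      identity.\<close>
    have "z * z * z = s * (z * z) - r * z + 1"
      using that unfolding abc[symmetric] s_def r_def by (auto simp: algebra_simps)
    from arg_cong[OF this, of "\<lambda>t. t * z ^ k"] show ?thesis
      by (simp add: algebra_simps)
  qed
  have abc_in: "a \<in> {a, b, c}" "b \<in> {a, b, c}" "c \<in> {a, b, c}" by simp_all
  have "a ^ Suc (Suc (Suc k)) + b ^ Suc (Suc (Suc k)) + c ^ Suc (Suc (Suc k)) =
    s * (a ^ Suc (Suc k) + b ^ Suc (Suc k) + c ^ Suc (Suc k)) -
    r * (a ^ Suc k + b ^ Suc k + c ^ Suc k) + (a ^ k + b ^ k + c ^ k)"
    unfolding abc_in[THEN cubic] by (simp add: algebra_simps del: power_Suc)
  also have "\<dots> = s * (E A2 + E B2 * s) - r * (E A1 + E B1 * s) + (E A0 + E B0 * s)"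
    using 4 by (simp only: 0 1 2 fst_conv snd_conv)
  also have "\<dots> = E (fst (power_sum_poly (Suc (Suc (Suc k))))) +
      E (snd (power_sum_poly (Suc (Suc (Suc k))))) * s"
    by (simp add: 0 1 2 E_def algebra_simps)
  finally show ?case .
qed (simp_all add: E_def s_def)

lemma poly_map2_G2_poly_explicit:
  fixes a b c :: "'a::comm_ring_1"
  assumes abc: "a * b * c = 1"
  shows "poly_map2 (G2_poly_explicit k) (G2_point a b c) = G2_point (a ^ k) (b ^ k) (c ^ k)"
proof -
  define s r where "s = a + b + c" and "r = a * b + b * c + c * a"
  define E where "E = (\<lambda>P. eval2 P (s + r) (s * r - 3))"
  obtain A B where AB: "power_sum_poly k = (A, B)" by fastforce
  have 1: "a ^ k + b ^ k + c ^ k = E A + E B * s"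
    using power_sum_poly_eval[OF abc, of k] by (simp add: AB E_def s_def r_def)
  \<comment> \<open>The triple \<open>ab, bc, ca\<close> consists of the inverses of
    \<open>c, a, b\<close>. It exchanges \<open>s\<close> and \<open>r\<close> but has the same
    \<open>s + r\<close> and \<open>s r\<close>, so the same \<open>A\<close> and \<open>B\<close>
    give its power sums.\<close>
  have abc': "(a * b) * (b * c) * (c * a) = 1"
  proof -
    have "(a * b) * (b * c) * (c * a) = (a * b * c) * (a * b * c)" by (simp add: mult_ac)
    thus ?thesis by (simp add: abc)
  qed
  have s': "(a * b) * (b * c) + (b * c) * (c * a) + (c * a) * (a * b) = s"
  proof -
    have "(a * b) * (b * c) + (b * c) * (c * a) + (c * a) * (a * b) = (a * b * c) * s"
      by (simp add: s_def algebra_simps)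
    thus ?thesis by (simp add: abc)
  qed
  have 2: "a ^ k * b ^ k + b ^ k * c ^ k + c ^ k * a ^ k = E A + E B * r"
    using power_sum_poly_eval[OF abc', of k] unfolding s'
    by (simp add: AB E_def r_def[symmetric] power_mult_distrib add.commute[of r] mult.commute[of r])
  show ?thesis
    by (simp add: G2_point_def Let_def 1 2 poly_map2_def G2_poly_explicit_def AB
        flip: s_def r_def) (simp add: E_def algebra_simps power2_eq_square)
qed

section \<open>Parametrization of points over an algebraically closed field\<close>

lemma quadratic_root_exists:
  fixes u v :: "'a::alg_closed_field"
  shows "\<exists>t. t ^ 2 = u * t - v"
proof -
  have "\<exists>t. poly [:v, -u, 1:] t = 0"
    by (rule alg_closed_imp_poly_has_root) simp
  thus ?thesis by (auto simp: algebra_simps power2_eq_square eq_neg_iff_add_eq_0)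
qed

lemma G2_point_surj:
  fixes x y :: "'a::alg_closed_field"
  obtains a b c where "a * b * c = 1" "G2_point a b c = (x, y)"
proof -
  obtain s where s: "s ^ 2 = x * s - (y + 3)"
    using quadratic_root_exists by blast
  define r where "r = x - s"
  have "\<exists>t. poly [:-1, r, -s, 1:] t = 0"
    by (rule alg_closed_imp_poly_has_root) simp
  then obtain a where "poly [:-1, r, -s, 1:] a = 0" ..
  hence a: "a * (a * (s - a)) = a * r - 1"
    by (simp add: algebra_simps) algebra
  have [simp]: "a \<noteq> 0" using a by auto
  \<comment> \<open>\<open>b\<close> and \<open>c\<close> must have sum \<open>s - a\<close> and
    product \<open>1 / a\<close>.\<close>
  obtain b where b: "b ^ 2 = (s - a) * b - 1 / a"
    using quadratic_root_exists by blast
  define c where "c = s - a - b"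
  have bc: "b * c = 1 / a"
    using b by (simp add: c_def algebra_simps power2_eq_square)
  have "a * b * c = 1"
    using bc by (simp add: mult.assoc)
  moreover have "a * b + b * c + c * a = a * (s - a) + 1 / a"
    using bc by (simp add: c_def algebra_simps)
  hence "a * (a * b + b * c + c * a) = a * r"
    using a by (simp add: distrib_left)
  hence "a * b + b * c + c * a = r" by simp
  hence "G2_point a b c = (x, y)"
    using s by (simp add: G2_point_def c_def)
      (simp add: r_def algebra_simps power2_eq_square)
  ultimately show ?thesis using that by blast
qed

section \<open>The complex exponential and the identification of \<open>G2_poly\<close>\<close>

lemma e2pi_add: "e2pi (z + w) = e2pi z * e2pi w"
  by (simp add: e2pi_def exp_add algebra_simps)

lemma e2pi_minus: "e2pi (- z) = inverse (e2pi z)"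
  by (simp add: e2pi_def exp_minus)

lemma e2pi_nonzero [simp]: "e2pi z \<noteq> 0"
  by (simp add: e2pi_def)

lemma e2pi_of_nat_mult: "e2pi (of_nat k * z) = e2pi z ^ k"
  by (simp add: e2pi_def mult_ac flip: exp_of_nat_mult)

lemma e2pi_surj:
  assumes "a \<noteq> 0"
  obtains z where "e2pi z = a"
proof
  define w where "w = of_real (ln (cmod a)) + \<i> * of_real (Arg a)"
  have "exp w = a"
    using rcis_cmod_Arg[of a] assms
    by (simp add: w_def exp_add cis_conv_exp rcis_def exp_of_real)
  moreover have "2 * of_real pi * \<i> * (w / (2 * of_real pi * \<i>)) = w" by simp
  ultimately show "e2pi (w / (2 * of_real pi * \<i>)) = a" by (simp only: e2pi_def)
qed

lemma Phi_G2_eq_G2_point: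
  "Phi_G2 (\<sigma>, \<tau>) = G2_point (e2pi \<sigma>) (e2pi \<tau>) (inverse (e2pi \<sigma> * e2pi \<tau>))"
proof -
  define a b where "a = e2pi \<sigma>" and "b = e2pi \<tau>"
  define u v where "u = inverse a" and "v = inverse b"
  have uv: "a * u = 1" "b * v = 1"
    by (simp_all add: a_def b_def u_def v_def)
  have e: "e2pi \<sigma> = a" "e2pi \<tau> = b" "e2pi (- \<sigma>) = u" "e2pi (- \<tau>) = v"
    by (simp_all add: a_def b_def u_def v_def e2pi_minus)
  have 1: "phi1 \<sigma> \<tau> = a + b + a * b + u + v + u * v"
    unfolding phi1_def minus_add_distrib e2pi_add e by simp
  have 2: "phi2 \<sigma> \<tau> = a * a * b + a * b * b + a * v + u * u * v + u * v * v + u * b"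
    unfolding phi2_def mult_2 minus_diff_eq minus_add_distrib diff_conv_add_uminus minus_minus e2pi_add e
    by (simp add: mult_ac)
  have "b * (u * v) = u * (b * v)" "(u * v) * a = v * (a * u)"
    by (simp_all only: mult_ac)
  hence r: "a * b + b * (u * v) + (u * v) * a = a * b + u + v"
    by (simp only: uv mult_1_right)
  have "(a + b + u * v) * (a * b + u + v) = a * a * b + a * b * b + a * v + u * u * v + u * v * v + u * b
      + (a * u) + (b * v) + (a * u) * (b * v)"
    by (simp add: algebra_simps)
  \<comment> \<open>Of the nine products, six are the terms of \<open>phi2\<close> and three equal
    1; this accounts for the \<open>- 3\<close> in \<open>G2_point\<close>.\<close>
  hence "(a + b + u * v) * (a * b + u + v) - 3 = phi2 \<sigma> \<tau>"
    by (simp add: uv 2)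
  thus ?thesis
    by (simp add: Phi_G2_def G2_point_def Let_def e inverse_mult_distrib r 1 flip: u_def v_def)
qed

lemma Phi_G2_surj: "\<exists>\<sigma> \<tau>. Phi_G2 (\<sigma>, \<tau>) = (x, y)"
proof -
  obtain a b c where abc: "a * b * c = 1" "G2_point a b c = (x, y)"
    using G2_point_surj .
  hence nz: "a \<noteq> 0" "b \<noteq> 0" by auto
  obtain \<sigma> where "e2pi \<sigma> = a" using e2pi_surj nz by blast
  moreover obtain \<tau> where "e2pi \<tau> = b" using e2pi_surj nz by blast
  moreover have "c = inverse (a * b)" using abc(1) nz by (simp add: field_simps)
  ultimately show ?thesis using abc(2) by (auto simp: Phi_G2_eq_G2_point)
qed

text \<open>Uniqueness holds because \<open>Phi_G2\<close> is onto and a polynomial with integer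
  coefficients is determined by its complex values.\<close>

lemma G2_poly_eq: "G2_poly k = G2_poly_explicit k"
  unfolding G2_poly_def
proof (rule the_equality)
  show expl: "\<forall>\<sigma> \<tau>. Phi_G2 (of_nat k * \<sigma>, of_nat k * \<tau>) =
      poly_map2 (G2_poly_explicit k) (Phi_G2 (\<sigma>, \<tau>))"
  proof (intro allI)
    fix \<sigma> \<tau>
    have "e2pi \<sigma> * e2pi \<tau> * inverse (e2pi \<sigma> * e2pi \<tau>) = 1"
      by (intro right_inverse) simp
    from poly_map2_G2_poly_explicit[OF this, of k]
    show "Phi_G2 (of_nat k * \<sigma>, of_nat k * \<tau>) =
        poly_map2 (G2_poly_explicit k) (Phi_G2 (\<sigma>, \<tau>))"
      by (simp only: Phi_G2_eq_G2_point e2pi_of_nat_mult power_mult_distrib power_inverse)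
  qed
  fix PQ assume "\<forall>\<sigma> \<tau>. Phi_G2 (of_nat k * \<sigma>, of_nat k * \<tau>) = poly_map2 PQ (Phi_G2 (\<sigma>, \<tau>))"
  with expl have "poly_map2 PQ (Phi_G2 (\<sigma>, \<tau>)) = poly_map2 (G2_poly_explicit k) (Phi_G2 (\<sigma>, \<tau>))"
    for \<sigma> \<tau> by simp
  hence "poly_map2 PQ (x, y) = poly_map2 (G2_poly_explicit k) (x, y)" for x y :: complex
    using Phi_G2_surj[of x y] by metis
  thus "PQ = G2_poly_explicit k"
    by (intro prod_eqI eval2_complex_eqD) (simp_all add: poly_map2_def)
qed

lemma poly_map2_G2_poly:
  fixes a b c :: "'a::comm_ring_1"
  assumes "a * b * c = 1"
  shows "poly_map2 (G2_poly k) (G2_point a b c) = G2_point (a ^ k) (b ^ k) (c ^ k)"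
  using assms by (simp add: G2_poly_eq poly_map2_G2_poly_explicit)

section \<open>Finite fields inside their algebraic closures\<close>

lemma to_ac_poly_map2:
  "map_prod to_ac to_ac (poly_map2 PQ xy) = poly_map2 PQ (map_prod to_ac to_ac xy)"
  by (cases xy) (simp add: poly_map2_def to_ac_eval2)

text \<open>Multiplication by a nonzero \<open>x\<close> permutes the nonzero elements, so it
  preserves their product.\<close>

lemma power_CARD_eq_same:
  fixes x :: "'a::{field,finite}"
  shows "x ^ CARD('a) = x"
proof (cases "x = 0")
  case False
  have "(\<Prod>y\<in>UNIV - {0}. x * y) = \<Prod>(UNIV - {0})"
    by (rule prod.reindex_bij_witness[of _ "\<lambda>y. y / x" "\<lambda>y. x * y"]) (use False in auto)
  hence "x ^ (CARD('a) - 1) = 1"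
    by (simp add: prod.distrib)
  moreover have "CARD('a) = Suc (CARD('a) - 1)"
    by simp
  ultimately show ?thesis by (metis mult.right_neutral power_Suc)
qed simp

lemma CHAR_eq_prime_of_CARD:
  assumes "prime p" "CARD('a::{field,finite}) = p ^ n"
  shows "CHAR('a) = p"
proof -
  have "CHAR('a) > 0"
    by (intro finite_imp_CHAR_pos) simp
  hence "prime CHAR('a)"
    by (rule prime_CHAR_semidom)
  moreover have "CHAR('a) dvd p ^ n"
    using CHAR_dvd_CARD[where ?'a = 'a] assms(2) by simp
  ultimately show ?thesis
    using assms(1) by (metis prime_dvd_power primes_dvd_imp_eq)
qed

text \<open>The polynomial \<open>T^q - T\<close> has at most \<open>q\<close> roots, and the
  embedded field already provides that many.\<close>

lemma power_CARD_fixed_imp_range_to_ac: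
  fixes z :: "'a::{field,finite} alg_closure"
  assumes "z ^ CARD('a) = z"
  shows "z \<in> range to_ac"
proof -
  define q where "q = CARD('a)"
  have q: "q > 1"
    using card_mono[of "UNIV :: 'a set" "{0, 1}"] by (simp add: q_def)
  define P :: "'a alg_closure poly" where "P = monom 1 q - monom 1 1"
  have "coeff P q = 1" using q by (simp add: P_def)
  hence P: "P \<noteq> 0" by auto
  have "degree P \<le> q" unfolding P_def
    using q by (intro degree_diff_le) (auto simp: degree_monom_eq)
  with card_poly_roots_bound[OF P] have le: "card {z. poly P z = 0} \<le> q" by simp
  have roots: "{z. poly P z = 0} = {z. z ^ q = z}"
    by (simp add: P_def poly_monom)
  have "range (to_ac :: 'a \<Rightarrow> _) \<subseteq> {z. poly P z = 0}"
    unfolding roots q_def by (auto simp: power_CARD_eq_same simp flip: to_ac_power)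
  moreover have "card (range (to_ac :: 'a \<Rightarrow> _)) = q"
    by (simp add: card_image inj_to_ac q_def)
  ultimately have "range (to_ac :: 'a \<Rightarrow> _) = {z. poly P z = 0}"
    using le poly_roots_finite[OF P] by (intro card_seteq) auto
  thus ?thesis using assms by (simp add: roots q_def)
qed

text \<open>A permutation of at most three elements has order 1, 2 or 3. The letters may
  coincide.\<close>

lemma iterate_6_on_triple:
  assumes inj: "inj_on f {a, b, c}" and img: "f ` {a, b, c} \<subseteq> {a, b, c}" and z: "z \<in> {a, b, c}"
  shows "(f ^^ 6) z = z"
proof -
  obtain u v where uv: "{a, b, c} = {z, u, v}"
    using z by auto
  have "f z = z \<or> f z = u \<or> f z = v" "f u = z \<or> f u = u \<or> f u = v"
    "f v = z \<or> f v = u \<or> f v = v"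
    using img unfolding uv by blast+
  moreover have "f z = f u \<longrightarrow> z = u" "f z = f v \<longrightarrow> z = v" "f u = f v \<longrightarrow> u = v"
    using inj unfolding uv by (blast dest: inj_onD)+
  ultimately have "f (f (f (f (f (f z))))) = z"
    by (elim disjE) metis+
  thus ?thesis by (simp add: numeral_eq_Suc)
qed

section \<open>Prime divisors of \<open>q^6 - 1\<close> and roots of unity\<close>

lemma prime_dvd_power6_minus_1_cases:
  fixes l q :: nat
  assumes "prime l" "l dvd q ^ 6 - 1"
  shows "l dvd q - 1 \<or> l dvd q + 1 \<or> l dvd q ^ 4 + q\<^sup>2 + 1"
proof -
  define W where "W = (q + 1) * (q ^ 4 + q\<^sup>2 + 1)"
  \<comment> \<open>\<open>W\<close> is the geometric sum \<open>1 + q + ... + q^5\<close>; the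
    additive form avoids truncated subtraction.\<close>
  have "q * W + 1 = q ^ 6 + W"
    by (simp add: W_def numeral_eq_Suc distrib_left distrib_right)
  hence "q ^ 6 - 1 = (q - 1) * W"
    by (simp add: diff_mult_distrib)
  thus ?thesis using assms unfolding W_def by (metis prime_dvd_mult_iff)
qed

text \<open>A root of \<open>1 + z + ... + z^(l-1)\<close> serves: at 1 this sum takes the value
  \<open>l\<close>, which is nonzero in the field.\<close>

lemma nontrivial_root_of_unity_exists:
  assumes "prime l" "of_nat l \<noteq> (0 :: 'a::alg_closed_field)"
  obtains z :: "'a::alg_closed_field" where "z ^ l = 1" "z \<noteq> 1"
proof -
  have "l > 1" using assms(1) prime_gt_1_nat by blast
  then obtain n where n: "l = Suc n" "n > 0" by (cases l) auto
  have "\<exists>z::'a. (\<Sum>k\<le>n. 1 * z ^ k) = 0"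
    by (rule alg_closed) (use n in auto)
  then obtain z :: 'a where z: "(\<Sum>k\<le>n. z ^ k) = 0" by auto
  have "z ^ l - 1 = (z - 1) * (\<Sum>k\<le>n. z ^ k)"
    unfolding n using power_diff_1_eq[of z "Suc n"] by (simp only: lessThan_Suc_atMost)
  moreover have "z \<noteq> 1" using z assms(2) by (auto simp: n)
  ultimately show ?thesis using that z by simp
qed

text \<open>Here \<open>s + r = 6\<close> and \<open>s r = 9\<close> force \<open>s = r = 3\<close>,
  so \<open>a\<close> is a root of \<open>(T - 1)^3\<close>, in any characteristic.\<close>

lemma G2_point_eq_6_6D:
  fixes a b c :: "'a::idom"
  assumes "a * b * c = 1" "G2_point a b c = (6, 6)"
  shows "a = 1"
proof -
  define s r where "s = a + b + c" and "r = a * b + b * c + c * a"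
  have sr: "s + r = 6" "s * r = 9"
    using assms(2) by (auto simp: G2_point_def Let_def s_def r_def algebra_simps)
  have "(s - 3) ^ 2 = s ^ 2 - s * 6 + 9"
    by (simp add: power2_eq_square algebra_simps)
  also have "\<dots> = 0"
    unfolding sr[symmetric] by (simp add: power2_eq_square algebra_simps)
  finally have s: "s = 3" by simp
  hence r: "r = 3" using sr by (simp add: algebra_simps)
  have "a * a * a - s * (a * a) + r * a - a * b * c = 0"
    by (simp add: s_def r_def algebra_simps)
  hence "a * a * a - 3 * (a * a) + 3 * a - 1 = 0"
    by (simp only: s r assms(1))
  hence "(a - 1) ^ 3 = 0"
    by (simp add: power3_eq_cube algebra_simps)
  thus "a = 1" by simp
qed

section \<open>Frobenius and the map over the field with \<open>q\<close> elements\<close>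

context
  fixes p n q :: nat
  assumes p: "prime p" and n: "n \<ge> 1" and q: "q = p ^ n"
    and card: "CARD('a::{field,finite}) = q"
begin

lemma q_gt_1: "q > 1"
  using p n q by (metis one_less_power prime_gt_1_nat less_le_trans zero_less_one)

lemma frobenius_add: "(u + v) ^ q = u ^ q + (v ^ q :: 'a alg_closure)"
  using p q card CHAR_eq_prime_of_CARD[of p n, where ?'a = 'a] by (intro freshmans_dream') auto

lemma frobenius_diff: "(u - v) ^ q = u ^ q - (v ^ q :: 'a alg_closure)"
  using frobenius_add[of "u - v" v] by (simp add: algebra_simps)

lemma frobenius_to_ac: "to_ac (x :: 'a) ^ q = to_ac x"
  using power_CARD_eq_same[of x] by (simp add: card flip: to_ac_power)

lemma frobenius_of_nat: "of_nat m ^ q = (of_nat m :: 'a alg_closure)"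
  using frobenius_to_ac[of "of_nat m"] by simp

text \<open>\<open>s\<close> and \<open>r\<close> are the roots of
  \<open>T^2 - x T + (y + 3)\<close>, whose coefficients Frobenius fixes.\<close>

lemma frobenius_orbit_cases:
  fixes a b c :: "'a alg_closure"
  assumes "G2_point a b c = map_prod to_ac to_ac xy"
  defines "s \<equiv> a + b + c" and "r \<equiv> a * b + b * c + c * a"
  shows "s ^ q = s \<and> r ^ q = r \<or> s ^ q = r \<and> r ^ q = s"
proof -
  obtain x y where xy: "xy = (x, y)" by fastforce
  have x: "s + r = to_ac x" and y: "s * r = to_ac (y + 3)"
    using assms(1) by (auto simp: xy G2_point_def Let_def s_def r_def algebra_simps)
  have 1: "s ^ q + r ^ q = s + r"
    unfolding frobenius_add[symmetric] x by (rule frobenius_to_ac)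
  have 2: "s ^ q * r ^ q = s * r"
    unfolding power_mult_distrib[symmetric] y by (rule frobenius_to_ac)
  have "(s ^ q - s) * (s ^ q - r) = s ^ q * s ^ q - s ^ q * (s + r) + s * r"
    by (simp add: algebra_simps)
  also have "\<dots> = 0"
    unfolding 1[symmetric] 2[symmetric] by (simp add: algebra_simps)
  finally show ?thesis using 1 by auto
qed

lemma power_q6_of_G2_point:
  fixes a b c :: "'a alg_closure"
  assumes abc: "a * b * c = 1" and pt: "G2_point a b c = map_prod to_ac to_ac xy"
    and z: "z \<in> {a, b, c}"
  shows "z ^ (q ^ 6 - 1) = 1"
proof -
  define s r where "s = a + b + c" and "r = a * b + b * c + c * a"
  have root: "t \<in> {a, b, c} \<longleftrightarrow> t * t * t - s * (t * t) + r * t - 1 = 0" for t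
  proof -
    have "t * t * t - s * (t * t) + r * t - a * b * c = (t - a) * (t - b) * (t - c)"
      by (simp add: s_def r_def algebra_simps)
    thus ?thesis by (simp add: abc)
  qed
  have nz: "t \<noteq> 0" if "t \<in> {a, b, c}" for t
    using that abc by auto
  have inj: "inj (\<lambda>t::'a alg_closure. t ^ q)"
  proof (rule injI)
    fix u v :: "'a alg_closure" assume "u ^ q = v ^ q"
    hence "(u - v) ^ q = 0" by (simp add: frobenius_diff)
    thus "u = v" by simp
  qed
  have frob: "t ^ q * t ^ q * t ^ q - s ^ q * (t ^ q * t ^ q) + r ^ q * t ^ q - 1 = 0"
    if "t \<in> {a, b, c}" for t
  proof -
    have "(t * t * t - s * (t * t) + r * t - 1) ^ q = 0"
      using that q_gt_1 unfolding root by (simp add: zero_power)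
    thus ?thesis by (simp add: frobenius_add frobenius_diff power_mult_distrib)
  qed
  have "z ^ (q ^ 6) = z"
    using frobenius_orbit_cases[OF pt, folded s_def r_def]
  proof (elim disjE conjE)
    assume sr: "s ^ q = s" "r ^ q = r"
    have "((\<lambda>t. t ^ q) ^^ 6) z = z"
    proof (rule iterate_6_on_triple[OF _ _ z])
      show "(\<lambda>t. t ^ q) ` {a, b, c} \<subseteq> {a, b, c}"
        using frob unfolding sr root[symmetric] by blast
    qed (use inj in \<open>simp add: inj_on_def inj_def\<close>)
    thus ?thesis by (simp add: numeral_eq_Suc mult.assoc flip: power_mult)
  next
    \<comment> \<open>Exchanging \<open>s\<close> and \<open>r\<close> in the cubic inverts its
      roots, so Frobenius followed by inversion preserves \<open>{a, b, c}\<close>. Over six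
      iterations the inversions cancel.\<close>
    assume sr: "s ^ q = r" "r ^ q = s"
    have "((\<lambda>t. inverse (t ^ q)) ^^ 6) z = z"
    proof (rule iterate_6_on_triple[OF _ _ z])
      show "(\<lambda>t. inverse (t ^ q)) ` {a, b, c} \<subseteq> {a, b, c}"
      proof (rule image_subsetI)
        fix t assume t: "t \<in> {a, b, c}"
        define w where "w = t ^ q"
        have "w \<noteq> 0" using nz[OF t] by (simp add: w_def)
        moreover have "w * w * w - r * (w * w) + s * w - 1 = 0"
          using frob[OF t] unfolding sr w_def .
        ultimately show "inverse (t ^ q) \<in> {a, b, c}"
          unfolding root w_def[symmetric] by (simp add: field_simps)
      qed
      show "inj_on (\<lambda>t. inverse (t ^ q)) {a, b, c}"
        using inj by (auto simp: inj_on_def inj_def)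
    qed
    thus ?thesis by (simp add: numeral_eq_Suc power_inverse mult.assoc flip: power_mult)
  qed
  moreover have "q ^ 6 = Suc (q ^ 6 - 1)" using q_gt_1 by simp
  ultimately have "z * z ^ (q ^ 6 - 1) = z * 1"
    by (metis mult.right_neutral power_Suc)
  thus ?thesis using nz[OF z] by simp
qed

lemma bij_if_coprime:
  assumes "gcd k (q ^ 6 - 1) = 1"
  shows "bij (poly_map2 (G2_poly k) :: 'a \<times> 'a \<Rightarrow> 'a \<times> 'a)"
proof -
  define N where "N = q ^ 6 - 1"
  have "q ^ 6 \<ge> 2 ^ 6" using q_gt_1 by (intro power_mono) auto
  \<comment> \<open>For \<open>k = 0\<close> the gcd would be \<open>q^6 - 1\<close>, at least 63.
    Bezout over the naturals needs \<open>k\<close> nonzero.\<close>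
  hence "k \<noteq> 0" using assms by (auto intro!: Nat.gr0I)
  then obtain m j where m: "k * m = N * j + 1"
    using bezout_nat[of k N] assms by (auto simp: N_def)
  have pow: "(z ^ k) ^ m = z" if "z ^ N = 1" for z :: "'a alg_closure"
    using that by (simp add: m flip: power_mult) (simp add: power_mult)
  have "poly_map2 (G2_poly m) (poly_map2 (G2_poly k) xy) = xy" for xy :: "'a \<times> 'a"
  proof -
    obtain a b c where abc: "a * b * c = 1" "G2_point a b c = map_prod to_ac to_ac xy"
      using G2_point_surj[of "to_ac (fst xy)" "to_ac (snd xy)"] by (auto simp: map_prod_def split_beta)
    have N: "z ^ N = 1" if "z \<in> {a, b, c}" for z
      unfolding N_def using power_q6_of_G2_point[OF abc that] .
    have abck: "a ^ k * b ^ k * c ^ k = 1"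
      using abc(1) by (simp flip: power_mult_distrib)
    have "map_prod to_ac to_ac (poly_map2 (G2_poly m) (poly_map2 (G2_poly k) xy)) =
        map_prod to_ac to_ac xy"
      using N abc by (simp add: to_ac_poly_map2 poly_map2_G2_poly abck pow flip: abc(2))
    thus ?thesis
      by (simp add: prod_eq_iff)
  qed
  hence "inj (poly_map2 (G2_poly k) :: 'a \<times> 'a \<Rightarrow> 'a \<times> 'a)"
    by (rule inj_on_inverseI)
  thus ?thesis
    by (simp add: bij_def finite_UNIV_inj_surj)
qed

lemma torsion_triple_exists:
  assumes l: "prime l" "l dvd q ^ 6 - 1"
  obtains a b c :: "'a alg_closure" and xy :: "'a \<times> 'a" where
    "a * b * c = 1" "a ^ l = 1" "b ^ l = 1" "c ^ l = 1" "a \<noteq> 1"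
    "G2_point a b c = map_prod to_ac to_ac xy"
proof -
  have q6: "q ^ 6 \<ge> 1" using q_gt_1 by simp
  have "l \<noteq> p"
  proof
    assume "l = p"
    moreover have "p dvd q ^ 6" using n q by (simp add: dvd_power flip: power_mult)
    ultimately have "p dvd 1" using l(2) q6 by (metis dvd_diffD1)
    thus False using p not_prime_unit by blast
  qed
  hence "of_nat l \<noteq> (0 :: 'a alg_closure)"
    using l(1) p primes_dvd_imp_eq CHAR_eq_prime_of_CARD[of p n, where ?'a = 'a] card q
    by (auto simp: of_nat_eq_0_iff_char_dvd)
  then obtain z :: "'a alg_closure" where z: "z ^ l = 1" "z \<noteq> 1"
    using nontrivial_root_of_unity_exists l(1) by blast
  have nz: "z \<noteq> 0" using z l(1) by (auto simp: zero_power prime_gt_0_nat)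
  have z_dvd: "z ^ m = 1" if "l dvd m" for m
    using that z(1) by (auto simp: power_mult elim!: dvdE)
  \<comment> \<open>Converse of \<open>frobenius_orbit_cases\<close>: both coordinates are then
    fixed by Frobenius, hence lie in the finite field.\<close>
  have rational: "\<exists>xy. G2_point a b c = map_prod to_ac to_ac (xy :: 'a \<times> 'a)"
    if "s ^ q = s \<and> r ^ q = r \<or> s ^ q = r \<and> r ^ q = s"
      "s = a + b + c" "r = a * b + b * c + c * a" for a b c s r :: "'a alg_closure"
  proof -
    have "(s + r) ^ q = s + r" using that(1) by (auto simp: frobenius_add)
    moreover have "(s * r - 3) ^ q = s * r - 3"
      using that(1) frobenius_of_nat[of 3] by (auto simp: frobenius_diff power_mult_distrib)
    ultimately obtain x y :: 'a where "s + r = to_ac x" "s * r - 3 = to_ac y"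
      using power_CARD_fixed_imp_range_to_ac card by (metis rangeE)
    thus ?thesis using that(2,3) by (intro exI[of _ "(x, y)"]) (simp add: G2_point_def)
  qed
  show ?thesis
  proof (cases "l dvd q ^ 4 + q\<^sup>2 + 1")
    case True
    define b c where "b = z ^ (q ^ 2)" and "c = z ^ (q ^ 4)"
    have zbc: "z * b * c = 1"
      using z_dvd[OF True] by (simp add: b_def c_def power_add mult_ac)
    \<comment> \<open>With \<open>t = q - 1\<close>, the factor \<open>q^2 - q + 1\<close> becomes
      \<open>q * t + 1\<close>.\<close>
    obtain t where t: "q = Suc t" using q_gt_1 by (cases q) auto
    have "q ^ 4 + q\<^sup>2 + 1 = (q\<^sup>2 + q + 1) * (q * t + 1)"
      by (simp add: t numeral_eq_Suc algebra_simps)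
    with True l(1) have "l dvd q\<^sup>2 + q + 1 \<or> l dvd q * t + 1"
      by (metis prime_dvd_mult_iff)
    hence "\<exists>xy. G2_point z b c = map_prod to_ac to_ac (xy :: 'a \<times> 'a)"
    proof
      \<comment> \<open>Now \<open>q^3\<close> is 1 modulo \<open>l\<close>, so Frobenius permutes
        the triple cyclically and fixes \<open>s\<close> and \<open>r\<close>.\<close>
      assume "l dvd q\<^sup>2 + q + 1"
      hence 1: "z ^ (q\<^sup>2 + q + 1) = 1" by (rule z_dvd)
      hence "z ^ (q ^ 3 + q\<^sup>2 + q) = z ^ (q\<^sup>2 + q + 1)"
        by (intro trans[OF z_dvd 1[symmetric]] dvd_trans[OF \<open>l dvd q\<^sup>2 + q + 1\<close>] dvdI[of _ _ q])
          (simp add: numeral_eq_Suc algebra_simps)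
      hence q3: "z ^ (q ^ 3) = z" using nz by (simp add: power_add)
      have F: "z ^ q = c" "b ^ q = z" "c ^ q = b"
      proof -
        have "c = (z ^ (q ^ 3)) ^ q"
          by (simp add: c_def numeral_eq_Suc mult_ac flip: power_mult)
        thus c: "z ^ q = c" by (simp add: q3)
        have "b ^ q = z ^ (q ^ 3)"
          by (simp add: b_def numeral_eq_Suc mult_ac flip: power_mult)
        thus "b ^ q = z" by (simp add: q3)
        show "c ^ q = b"
          by (simp add: b_def power2_eq_square flip: c power_mult)
      qed
      show ?thesis
        by (rule rational[OF _ refl refl])
          (simp add: frobenius_add power_mult_distrib F add_ac mult_ac)
    next
      \<comment> \<open>Now \<open>q^3\<close> is -1 modulo \<open>l\<close>, so Frobenius sends
        \<open>z, b, c\<close> to the inverses of \<open>c, z, b\<close>, written as products of two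
        entries; it swaps \<open>s\<close> and \<open>r\<close>.\<close>
      assume *: "l dvd q * t + 1"
      have "q ^ 3 + 1 = (q * t + 1) * (q + 1)"
        by (simp add: t numeral_eq_Suc algebra_simps)
      with * have "z ^ (q ^ 3 + 1) = 1" by (intro z_dvd) (simp only: dvd_mult2)
      hence q3: "z ^ (q ^ 3) * z = 1" by (simp add: power_add mult.commute)
      have F: "z ^ q = z * b" "b ^ q = b * c" "c ^ q = c * z"
      proof -
        have "z ^ q * c = (z ^ (q ^ 3) * z) ^ q"
          by (simp add: c_def numeral_eq_Suc mult_ac power_mult_distrib flip: power_mult)
        hence "z ^ q * c = z * b * c" by (simp add: q3 zbc)
        moreover have "c \<noteq> 0" using nz by (simp add: c_def)
        ultimately show "z ^ q = z * b" by simp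
        have "b ^ q = z ^ (q ^ 3)"
          by (simp add: b_def numeral_eq_Suc mult_ac flip: power_mult)
        hence "b ^ q * z = b * c * z" using q3 zbc by (simp add: mult_ac)
        thus "b ^ q = b * c" using nz by simp
        have "c ^ q * b = (z ^ (q ^ 3) * z) ^ (q\<^sup>2)"
          by (simp add: b_def c_def numeral_eq_Suc mult_ac power_mult_distrib flip: power_mult)
        hence "c ^ q * b = 1" by (simp only: q3 power_one)
        hence "c ^ q * b = c * z * b" using zbc by (simp add: mult_ac)
        moreover have "b \<noteq> 0" using nz by (simp add: b_def)
        ultimately show "c ^ q = c * z" by simp
      qed
      have "(z * b) * (b * c) + (b * c) * (c * z) + (c * z) * (z * b) = (z * b * c) * (z + b + c)"
        by (simp add: algebra_simps)
      thus ?thesis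
        by (intro rational[OF _ refl refl])
          (simp add: frobenius_add power_mult_distrib F zbc)
    qed
    moreover have "b ^ l = 1" "c ^ l = 1"
      using z(1) by (simp_all add: b_def c_def flip: power_mult)
        (simp_all add: mult.commute[of _ l] power_mult)
    ultimately show ?thesis using that[of z b c] z zbc by blast
  next
    case False
    hence "l dvd q - 1 \<or> l dvd q + 1"
      using prime_dvd_power6_minus_1_cases[OF l] by auto
    hence zq: "z ^ q = z \<or> z ^ q = inverse z"
    proof
      assume "l dvd q - 1"
      hence "z ^ (q - 1) = 1" by (rule z_dvd)
      hence "z ^ q = z" using q_gt_1 by (metis power_eq_if mult.right_neutral not_less_zero)
      thus ?thesis ..
    next
      assume "l dvd q + 1"
      hence "z ^ (q + 1) = 1" by (rule z_dvd)
      thus ?thesis using nz by (simp add: field_simps)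
    qed
    \<comment> \<open>For the triple \<open>z, 1/z, 1\<close> both symmetric sums equal this
      \<open>s\<close>, which is unchanged when \<open>z\<close> is inverted.\<close>
    define s where "s = z + inverse z + 1"
    have "s ^ q = s" using zq by (auto simp: s_def frobenius_add power_inverse)
    hence "\<exists>xy. G2_point z (inverse z) 1 = map_prod to_ac to_ac (xy :: 'a \<times> 'a)"
      by (intro rational[of s s]) (use nz in \<open>auto simp: s_def\<close>)
    thus ?thesis using that[of z "inverse z" 1] z nz by (auto simp: power_inverse)
  qed
qed

lemma not_bij_if_not_coprime:
  assumes "gcd k (q ^ 6 - 1) \<noteq> 1"
  shows "\<not> bij (poly_map2 (G2_poly k) :: 'a \<times> 'a \<Rightarrow> 'a \<times> 'a)"
proof
  assume bij: "bij (poly_map2 (G2_poly k) :: 'a \<times> 'a \<Rightarrow> 'a \<times> 'a)"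
  obtain l where l: "prime l" "l dvd k" "l dvd q ^ 6 - 1"
    using prime_factor_nat[OF assms] by auto
  obtain a b c :: "'a alg_closure" and xy :: "'a \<times> 'a" where abc: "a * b * c = 1"
    and pow: "a ^ l = 1" "b ^ l = 1" "c ^ l = 1" and "a \<noteq> 1"
    and xy: "G2_point a b c = map_prod to_ac to_ac xy"
    using torsion_triple_exists[OF l(1,3)] .
  have pt1: "G2_point 1 1 1 = (6, 6 :: 'a alg_closure)"
    by (simp add: G2_point_def)
  have powk: "a ^ k = 1" "b ^ k = 1" "c ^ k = 1"
    using l(2) pow by (auto simp: power_mult elim!: dvdE)
  \<comment> \<open>All \<open>k\<close>-th powers are 1, so both sides are the point of
    \<open>(1, 1, 1)\<close>.\<close>
  have "map_prod to_ac to_ac (poly_map2 (G2_poly k) xy) =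
      map_prod to_ac to_ac (poly_map2 (G2_poly k) (6, 6))"
    using poly_map2_G2_poly[OF abc, of k] poly_map2_G2_poly[of "1 :: 'a alg_closure" 1 1 k]
    by (simp add: to_ac_poly_map2 xy[symmetric] powk pt1)
  hence "poly_map2 (G2_poly k) xy = poly_map2 (G2_poly k) (6, 6)"
    by (simp add: prod_eq_iff)
  hence "xy = (6, 6)" using bij by (simp add: bij_def inj_eq)
  hence "G2_point a b c = (6, 6)" using xy by simp
  thus False using G2_point_eq_6_6D abc \<open>a \<noteq> 1\<close> by blast
qed

end

theorem theorem3p6:
  fixes p q n k :: nat
  assumes "prime p" and "n \<ge> 1" and "q = p ^ n"
    and "CARD('a::{field,finite}) = q"
  shows "bij (poly_map2 (G2_poly k) :: 'a \<times> 'a \<Rightarrow> 'a \<times> 'a) \<longleftrightarrow> gcd k (q ^ 6 - 1) = 1"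
  using bij_if_coprime[OF assms, of k] not_bij_if_not_coprime[OF assms, of k] by argo

end
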